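(* Let $\vec\mu\in\mathbb{R}^3$, $\mu=|\vec\mu|$. For $a,\epsilon\in\,]0,1[$ let $$\vec H_{a,\epsilon}(\vec r\,)=\big[3\vec u(\vec\mu\cdot\vec u)-\vec\mu\big]\,\Upsilon_3(r)-\big[\vec u(\vec\mu\cdot\vec u)-\vec\mu\big]\,\Upsilon'_2(r)$$ be the Colombeau-regularized magnetic field of a point magnetic dipole, where $\Upsilon_3$ and $\Upsilon'_2$ are the regularizations of $r^{-3}\mathrm{H}(r-a)$ and $r^{-2}\delta(r-a)$ given in the context. Then the magnetic self-energy $$U_{\mathrm{mag}}(a,\epsilon)=\frac{1}{8\pi}\int_{\mathbb{R}^3}|\vec H_{a,\epsilon}(\vec r\,)|^2\,d^3r$$ satisfies, for every fixed $a\in\,]0,1[$, $$\lim_{\epsilon\to0^+}\left(U_{\mathrm{mag}}(a,\epsilon)-\frac{\mu^2}{3}\,\frac{1}{a^2}\,\frac{M}{\epsilon}\right)=0,\qquad M=\int_{-\infty}^{\infty}\eta(-z)^2\,dz .$$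
   Context: Mollifier: $\eta\in\mathcal{S}(\mathbb{R})$ is a fixed real-valued even Schwartz function with $\int_{\mathbb{R}}\eta(z)\,dz=1$ and $\int_{\mathbb{R}}z^n\eta(z)\,dz=0$ for all integers $n\ge1$. A distribution $f$ on $\mathbb{R}$ is regularized as $f_\epsilon(x)=\int_{\mathbb{R}}\frac1\epsilon\,\eta\big(\frac{y-x}{\epsilon}\big)f(y)\,dy$ (with the usual distributional meaning). Regularized functions: $\vec r\in\mathbb{R}^3$, $r=|\vec r\,|\ge0$, $\vec u=\vec r/r$, $\mathrm{H}$ is the Heaviside function, $\delta$ the Dirac distribution. For $n\ge1$, $\Upsilon_n$ and $\Upsilon'_n$ (depending on $a,\epsilon$) denote the regularizations of the distributions $y\mapsto y^{-n}\mathrm{H}(y-a)$ and $y\mapsto y^{-n}\delta(y-a)$, that is, $$\Upsilon_n(r)=\int_{(a-r)/\epsilon}^{\infty}\frac{\eta(z)}{(r+\epsilon z)^n}\,dz,\qquad \Upsilon'_n(r)=\frac{1}{a^n\epsilon}\,\eta\Big(\frac{a-r}{\epsilon}\Big).$$ In the formal notation $\Upsilon_n=r^{-n}\Upsilon$, $\Upsilon'_n=r^{-n}\Upsilon'$, the field is $\vec H=\vec\nabla\times\vec A$ with $\vec A=\frac{\vec\mu\times\vec r}{r^3}\Upsilon$. The limit $\epsilon\to0$ is always taken before $a\to0$. *)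

theory Defs
  imports "HOL-Analysis.Analysis"
begin

definition schwartz :: "(real \<Rightarrow> real) \<Rightarrow> bool" where
  "schwartz f \<longleftrightarrow>
     (\<forall>k x. (deriv ^^ k) f differentiable (at x)) \<and>
     (\<forall>m k. bounded (range (\<lambda>x. x ^ m * (deriv ^^ k) f x)))"

definition mollifier :: "(real \<Rightarrow> real) \<Rightarrow> bool" where
  "mollifier \<eta> \<longleftrightarrow>
     schwartz \<eta> \<and> (\<forall>z. \<eta> (- z) = \<eta> z) \<and>
     (LINT z|lborel. \<eta> z) = 1 \<and>
     (\<forall>n\<ge>1. (LINT z|lborel. z ^ n * \<eta> z) = 0)"

definition regularize :: "(real \<Rightarrow> real) \<Rightarrow> real \<Rightarrow> (real \<Rightarrow> real) \<Rightarrow> real \<Rightarrow> real" where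
  "regularize \<eta> \<epsilon> f x = (LINT y|lborel. 1 / \<epsilon> * \<eta> ((y - x) / \<epsilon>) * f y)"

definition Upsilon :: "(real \<Rightarrow> real) \<Rightarrow> real \<Rightarrow> real \<Rightarrow> nat \<Rightarrow> real \<Rightarrow> real" where
  "Upsilon \<eta> a \<epsilon> n r = (LINT z:{(a - r) / \<epsilon>..}|lborel. \<eta> z / (r + \<epsilon> * z) ^ n)"

text \<open>The regularization of \<open>y\<^sup>-\<^sup>n \<delta>(y - a)\<close>, i.e. that distribution applied to
  the test function \<open>y \<mapsto> \<eta>((y - r)/\<epsilon>) / \<epsilon>\<close>.\<close>

definition Upsilon' :: "(real \<Rightarrow> real) \<Rightarrow> real \<Rightarrow> real \<Rightarrow> nat \<Rightarrow> real \<Rightarrow> real" where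
  "Upsilon' \<eta> a \<epsilon> n r = 1 / (a ^ n * \<epsilon>) * \<eta> ((a - r) / \<epsilon>)"

lemma Upsilon_eq_regularize:
  assumes "\<epsilon> > 0"
  shows "Upsilon \<eta> a \<epsilon> n r = regularize \<eta> \<epsilon> (\<lambda>y. indicator {a..} y / y ^ n) r"
proof -
  have ind: "indicator {a..} (r + \<epsilon> * z) = (indicator {(a - r) / \<epsilon>..} z :: real)" for z
    using assms by (auto simp: indicator_def field_simps)
  have "regularize \<eta> \<epsilon> (\<lambda>y. indicator {a..} y / y ^ n) r =
      \<bar>\<epsilon>\<bar> *\<^sub>R (LINT z|lborel. 1 / \<epsilon> * \<eta> ((r + \<epsilon> * z - r) / \<epsilon>) *
        (indicator {a..} (r + \<epsilon> * z) / (r + \<epsilon> * z) ^ n))"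
    unfolding regularize_def using assms
    by (subst lborel_integral_real_affine[where c = \<epsilon> and t = r]) auto
  also have "\<dots> = (LINT z|lborel. \<epsilon> * (1 / \<epsilon> * \<eta> ((r + \<epsilon> * z - r) / \<epsilon>) *
        (indicator {a..} (r + \<epsilon> * z) / (r + \<epsilon> * z) ^ n)))"
    using assms by (simp only: integral_mult_right_zero) simp
  also have "\<dots> = Upsilon \<eta> a \<epsilon> n r"
    unfolding Upsilon_def set_lebesgue_integral_def
    using assms by (intro Bochner_Integration.integral_cong) (auto simp: ind)
  finally show ?thesis by simp
qed

text \<open>The unit vector \<open>sgn x = x /\<^sub>R norm x\<close> is \<open>0\<close> at the origin, a null set for the energy.\<close>

definition dipole_field ::
  "(real \<Rightarrow> real) \<Rightarrow> real ^ 3 \<Rightarrow> real \<Rightarrow> real \<Rightarrow> real ^ 3 \<Rightarrow> real ^ 3" where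
  "dipole_field \<eta> \<mu> a \<epsilon> x =
     (let u = sgn x; r = norm x in
        Upsilon \<eta> a \<epsilon> 3 r *\<^sub>R ((3 * (\<mu> \<bullet> u)) *\<^sub>R u - \<mu>)
        - Upsilon' \<eta> a \<epsilon> 2 r *\<^sub>R ((\<mu> \<bullet> u) *\<^sub>R u - \<mu>))"

definition U_mag :: "(real \<Rightarrow> real) \<Rightarrow> real ^ 3 \<Rightarrow> real \<Rightarrow> real \<Rightarrow> real" where
  "U_mag \<eta> \<mu> a \<epsilon> =
     1 / (8 * pi) * (LINT x|lborel. (norm (dipole_field \<eta> \<mu> a \<epsilon> x))\<^sup>2)"

end

(*
  With A = Upsilon_3 and B = Upsilon'_2, averaging over the angles (the mean of (mu.u)^2 is mu^2/3)
  gives U = mu^2 * int_0^oo r^2 (A^2 + B^2/3 - 2AB/3) dr. The B^2 term is the divergent mu^2 M / (3 a^2 eps)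
  up to O(eps). As eps -> 0, A tends to H(r - a)/r^3 and the A^2 term to 1/(3a^3), while in the cross
  term, rescaled by r = a + eps w, the limit is (1/a^3) int eta(w) G(w) dw with G(w) the integral of eta over
  [-w, oo). Evenness gives G(w) + G(-w) = 1, so this is 1/(2a^3) and the two finite parts cancel.
*)

theory Submission
  imports Defs "HOL-Probability.Sinc_Integral"
begin

text \<open>All positive moments of \<open>\<eta>\<close> vanish while its integral is 1, so
  \<open>\<eta>\<close> changes sign and cannot have compact support. Each passage to the limit
  rests on a majorant uniform in \<open>\<epsilon>\<close>: the cutoff at \<open>a\<close> keeps the
  denominator away from 0, and the decay of \<open>\<eta>\<close> pays for large \<open>z\<close>.

  The three terms need different precision. For A^2 a pointwise limit and a majorant suffice. The
  subtracted quantity grows like \<open>1 / \<epsilon>\<close>, so B^2 must be known up to o(1), one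
  order beyond its leading term; that next order would be a finite constant, and it vanishes because
  \<open>\<eta>\<close> is even. In AB, B concentrates exactly at the jump of A, so the product of
  the separate limits has no meaning; only the symmetry of \<open>\<eta>\<close> makes the result
  independent of its shape.\<close>

section \<open>Rotation invariance of Lebesgue measure and polar coordinates\<close>

text \<open>Boxes determine \<open>lborel\<close>, and the preimage of a box under \<open>T\<close>
  is its image under the inverse, again an orthogonal map and so volume preserving.\<close>

lemma distr_lborel_orthogonal_transformation:
  fixes T :: "real ^ 'n::{finite,wellorder} \<Rightarrow> real ^ 'n::_"
  assumes T: "orthogonal_transformation T"
  shows "distr lborel borel T = lborel"
proof (rule lborel_eqI[symmetric])
  fix l u :: "real ^ 'n::_"
  assume le: "\<And>b. b \<in> Basis \<Longrightarrow> l \<bullet> b \<le> u \<bullet> b"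
  have T_borel: "T \<in> borel_measurable borel"
    using T by (intro borel_measurable_continuous_onI linear_continuous_on)
      (simp add: linear_linear orthogonal_transformation_linear)
  have inv: "orthogonal_transformation (inv T)" "bij T"
    using T by (auto simp: orthogonal_transformation_inv orthogonal_transformation_bij)
  have vimage: "T -` box l u = inv T ` box l u"
    using inv(2) by (simp add: bij_vimage_eq_inv_image)
  have borel: "T -` box l u \<in> sets borel"
    using measurable_sets[OF T_borel, of "box l u"] by simp
  have fm: "inv T ` box l u \<in> lmeasurable"
    using inv(1) by (intro measurable_orthogonal_image) auto
  have "emeasure (distr lborel borel T) (box l u) = emeasure lborel (T -` box l u)"
    using T_borel by (subst emeasure_distr) auto
  also have "\<dots> = emeasure lebesgue (inv T ` box l u)"
    using borel by (simp add: vimage)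
  also have "\<dots> = measure lebesgue (inv T ` box l u)"
    using fm by (rule emeasure_eq_measure2)
  also have "measure lebesgue (inv T ` box l u) = measure lebesgue (box l u)"
    using inv(1) by (intro measure_orthogonal_image) auto
  also have "\<dots> = (\<Prod>b\<in>Basis. (u - l) \<bullet> b)"
    using le by (simp add: measure_lborel_box_eq inner_diff_left)
  finally show "emeasure (distr lborel borel T) (box l u) = (\<Prod>b\<in>Basis. (u - l) \<bullet> b)" .
qed simp

text \<open>The half-lines \<open>{..R}\<close> generate the Borel sets and pull back to balls. The
  density is the derivative in \<open>R\<close> of the ball volume, that is, the area of the
  sphere.\<close>

lemma distr_norm_lborel:
  "distr lborel borel (norm :: 'a::euclidean_space \<Rightarrow> real) =
     density lborel (\<lambda>r. indicator {0..} r * (real DIM('a) * unit_ball_vol DIM('a) * r ^ (DIM('a) - 1)))"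
    (is "?L = density lborel (\<lambda>r. ennreal (?d r))")
proof (rule measure_eqI_generator_eq)
  let ?E = "range (\<lambda>a::real. {..a})"
  let ?V = "unit_ball_vol (real DIM('a))"
  have "?V \<ge> 0"
    by simp
  have L: "emeasure ?L {..R} = (if R \<ge> 0 then ennreal (?V * R ^ DIM('a)) else 0)" for R
  proof -
    have "emeasure ?L {..R} = emeasure lborel (cball (0::'a) R)"
      by (simp add: emeasure_distr vimage_def cball_def)
    then show ?thesis
      by (auto simp: emeasure_cball)
  qed
  have R: "emeasure (density lborel (\<lambda>r. ennreal (?d r))) {..R} =
      (if R \<ge> 0 then ennreal (?V * R ^ DIM('a)) else 0)" for R
  proof (cases "R \<ge> 0")
    case True
    have "emeasure (density lborel (\<lambda>r. ennreal (?d r))) {..R} =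
        (\<integral>\<^sup>+r. ennreal (?d r) * indicator {..R} r \<partial>lborel)"
      by (rule emeasure_density) measurable
    also have "\<dots> = (\<integral>\<^sup>+r. ennreal (real DIM('a) * ?V * r ^ (DIM('a) - 1)) * indicator {0..R} r \<partial>lborel)"
      by (intro nn_integral_cong) (auto simp: indicator_def)
    also have "\<dots> = ennreal (?V * R ^ DIM('a) - ?V * 0 ^ DIM('a))"
    proof (rule nn_integral_FTC_Icc)
      show "((\<lambda>r. ?V * r ^ DIM('a)) has_real_derivative real DIM('a) * ?V * r ^ (DIM('a) - 1)) (at r)" for r
        by (auto intro!: derivative_eq_intros)
    qed (use True in auto)
    finally show ?thesis
      using True by simp
  next
    case False
    have "emeasure (density lborel (\<lambda>r. ennreal (?d r))) {..R} =
        (\<integral>\<^sup>+r. ennreal (?d r) * indicator {..R} r \<partial>lborel)"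
      by (rule emeasure_density) measurable
    also have "\<dots> = (\<integral>\<^sup>+r. 0 \<partial>(lborel :: real measure))"
      using False by (intro nn_integral_cong) (auto simp: indicator_def)
    finally show ?thesis
      using False by simp
  qed
  show "emeasure ?L X = emeasure (density lborel (\<lambda>r. ennreal (?d r))) X" if "X \<in> ?E" for X
    using that by (auto simp only: L R)
  show "sets ?L = sigma_sets UNIV ?E"
    by (simp add: borel_eq_atMost)
  show "sets (density lborel (\<lambda>r. ennreal (?d r))) = sigma_sets UNIV ?E"
    by (simp add: borel_eq_atMost)
  show "Int_stable ?E"
    by (auto simp: Int_stable_def)
  show "(\<Union>i::nat. {..real i}) = UNIV"
    by (auto intro: real_arch_simple)
  show "emeasure ?L {..real i} \<noteq> \<infinity>" for i
    by (simp add: L)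
qed auto

text \<open>Push-forward along \<open>norm\<close>. The formula for the integral holds for every
  measurable \<open>g\<close>, with value 0 on both sides when integrability fails; splitting sums
  later needs genuine integrability, hence the second claim.\<close>

lemma
  fixes g :: "real \<Rightarrow> real"
  assumes g[measurable]: "g \<in> borel_measurable borel"
  shows lborel_integral_radial:
      "(LINT x|lborel. g (norm (x::'a::euclidean_space))) =
        real DIM('a) * unit_ball_vol DIM('a) * (LINT r:{0..}|lborel. r ^ (DIM('a) - 1) * g r)"
    and lborel_integrable_radial:
      "set_integrable lborel {0..} (\<lambda>r. r ^ (DIM('a) - 1) * g r) \<Longrightarrow>
        integrable lborel (\<lambda>x::'a. g (norm x))"
proof -
  let ?c = "real DIM('a) * unit_ball_vol DIM('a)"
  let ?d = "\<lambda>r. indicator {0..} r * (?c * r ^ (DIM('a) - 1))"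
  have d: "AE r in lborel. 0 \<le> ?d r"
    by (auto simp: indicator_def)
  have "(LINT x|lborel. g (norm (x::'a))) = (LINT r|distr lborel borel (norm :: 'a \<Rightarrow> real). g r)"
    by (simp add: integral_distr)
  also have "\<dots> = (LINT r|lborel. ?d r *\<^sub>R g r)"
    unfolding distr_norm_lborel using d by (intro integral_density) auto
  also have "\<dots> = (LINT r|lborel. ?c * (indicator {0..} r *\<^sub>R (r ^ (DIM('a) - 1) * g r)))"
    by (intro Bochner_Integration.integral_cong) auto
  finally show "(LINT x|lborel. g (norm (x::'a))) =
      ?c * (LINT r:{0..}|lborel. r ^ (DIM('a) - 1) * g r)"
    unfolding set_lebesgue_integral_def by simp
  assume "set_integrable lborel {0..} (\<lambda>r. r ^ (DIM('a) - 1) * g r)"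
  then have "integrable lborel (\<lambda>r. ?c * (indicator {0..} r *\<^sub>R (r ^ (DIM('a) - 1) * g r)))"
    unfolding set_integrable_def by (rule integrable_mult_right)
  then have "integrable lborel (\<lambda>r. ?d r *\<^sub>R g r)"
    by (rule Bochner_Integration.integrable_cong[THEN iffD1, rotated -1]) auto
  then have "integrable (distr lborel borel (norm :: 'a \<Rightarrow> real)) g"
    unfolding distr_norm_lborel using d by (subst integrable_density) auto
  then show "integrable lborel (\<lambda>x::'a. g (norm x))"
    by (subst (asm) integrable_distr_eq) auto
qed

text \<open>Symmetry replaces a computation on the sphere: a rotation turns \<open>\<mu>\<close>
  into any coordinate axis, so all coordinates contribute equally, and the squares of the
  coordinates of a unit vector add up to 1.\<close>

lemma lborel_integral_radial_inner_sgn: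
  fixes g :: "real \<Rightarrow> real" and \<mu> :: "real ^ 'n::{finite,wellorder}"
  assumes g[measurable]: "g \<in> borel_measurable borel"
    and int: "integrable lborel (\<lambda>x::real ^ 'n::_. g (norm x))"
  shows "integrable lborel (\<lambda>x::real ^ 'n::_. g (norm x) * (\<mu> \<bullet> sgn x)\<^sup>2)"
    and "(LINT x|lborel. g (norm x) * (\<mu> \<bullet> sgn x)\<^sup>2) =
      (norm \<mu>)\<^sup>2 / CARD('n::_) * (LINT x|lborel. g (norm (x::real ^ 'n::_)))"
proof -
  have sgn_borel[measurable]: "(sgn :: real ^ 'n::_ \<Rightarrow> _) \<in> borel_measurable borel"
    unfolding sgn_div_norm[abs_def] by measurable
  have le: "(\<nu> \<bullet> sgn x)\<^sup>2 \<le> (norm \<nu>)\<^sup>2" for \<nu> x :: "real ^ 'n::_"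
  proof -
    have "\<bar>\<nu> \<bullet> sgn x\<bar> \<le> norm \<nu> * norm (sgn x)"
      by (rule Cauchy_Schwarz_ineq2)
    also have "\<dots> \<le> norm \<nu>"
      by (simp add: norm_sgn)
    finally show ?thesis
      by (simp add: abs_le_square_iff[symmetric])
  qed
  have int_sgn: "integrable lborel (\<lambda>x::real ^ 'n::_. g (norm x) * (\<nu> \<bullet> sgn x)\<^sup>2)" for \<nu>
  proof (rule Bochner_Integration.integrable_bound)
    show "integrable lborel (\<lambda>x::real ^ 'n::_. (norm \<nu>)\<^sup>2 * g (norm x))"
      using int by simp
    show "AE x in lborel. norm (g (norm x) * (\<nu> \<bullet> sgn x)\<^sup>2) \<le> norm ((norm \<nu>)\<^sup>2 * g (norm x))"
      using mult_right_mono[OF le] by (auto simp: abs_mult mult.commute)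
  qed measurable
  then show "integrable lborel (\<lambda>x::real ^ 'n::_. g (norm x) * (\<mu> \<bullet> sgn x)\<^sup>2)" .
  have rot: "(LINT x|lborel. g (norm x) * (\<mu> \<bullet> sgn x)\<^sup>2) =
      (norm \<mu>)\<^sup>2 * (LINT x|lborel. g (norm x) * (sgn x $ i)\<^sup>2)" for i :: 'n
  proof -
    \<comment> \<open>The axis vector is given the length of \<open>\<mu>\<close> rather than length
      1, so that \<open>\<mu> = 0\<close> needs no separate case.\<close>
    obtain T where T: "orthogonal_transformation T" "T (axis i (norm \<mu>)) = \<mu>"
      by (rule orthogonal_transformation_exists[of "axis i (norm \<mu>)" \<mu>])
        (auto simp: norm_eq_sqrt_inner inner_axis_axis)
    have T_borel[measurable]: "T \<in> borel_measurable borel"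
      using T by (intro borel_measurable_continuous_onI linear_continuous_on)
        (simp add: linear_linear orthogonal_transformation_linear)
    have "\<mu> \<bullet> sgn (T x) = norm \<mu> * (sgn x $ i)" for x
    proof -
      have "sgn (T x) = T (sgn x)"
        using T(1) by (simp add: sgn_div_norm orthogonal_transformation_norm
            linear_cmul orthogonal_transformation_linear)
      then have "\<mu> \<bullet> sgn (T x) = T (axis i (norm \<mu>)) \<bullet> T (sgn x)"
        using T(2) by simp
      also have "\<dots> = axis i (norm \<mu>) \<bullet> sgn x"
        using T(1) by (simp add: orthogonal_transformation_def)
      finally show ?thesis
        by (simp add: inner_axis')
    qed
    note T_sgn = this
    have "(LINT x|lborel. g (norm x) * (\<mu> \<bullet> sgn x)\<^sup>2) =
        (LINT x|distr lborel borel T. g (norm x) * (\<mu> \<bullet> sgn x)\<^sup>2)"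
      using T(1) by (simp add: distr_lborel_orthogonal_transformation)
    also have "\<dots> = (LINT x|lborel. g (norm (T x)) * (\<mu> \<bullet> sgn (T x))\<^sup>2)"
      by (intro integral_distr) auto
    also have "\<dots> = (LINT x|lborel. (norm \<mu>)\<^sup>2 * (g (norm x) * (sgn x $ i)\<^sup>2))"
      using T(1) by (intro Bochner_Integration.integral_cong)
        (auto simp: T_sgn orthogonal_transformation_norm power_mult_distrib)
    finally show ?thesis
      by simp
  qed
  have int_i: "integrable lborel (\<lambda>x::real ^ 'n::_. g (norm x) * (sgn x $ i)\<^sup>2)" for i
    using int_sgn[of "axis i 1"] by (simp add: inner_axis')
  have "CARD('n) * (LINT x|lborel. g (norm x) * (\<mu> \<bullet> sgn x)\<^sup>2) =
      (\<Sum>i\<in>UNIV. (norm \<mu>)\<^sup>2 * (LINT x|lborel. g (norm (x::real ^ 'n::_)) * (sgn x $ i)\<^sup>2))"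
    using rot by simp
  also have "\<dots> = (norm \<mu>)\<^sup>2 * (LINT x|lborel. (\<Sum>i\<in>UNIV. g (norm (x::real ^ 'n::_)) * (sgn x $ i)\<^sup>2))"
    using int_i by (simp add: sum_distrib_left)
  also have "(LINT x|lborel. (\<Sum>i\<in>UNIV. g (norm (x::real ^ 'n::_)) * (sgn x $ i)\<^sup>2)) =
      (LINT x|lborel. g (norm (x::real ^ 'n::_)))"
  \<comment> \<open>Only almost everywhere: at the origin \<open>sgn\<close> is 0 and the squares
    add up to 0.\<close>
  proof (rule integral_cong_AE)
    have "(\<Sum>i\<in>UNIV. (sgn x $ i)\<^sup>2) = 1" if "x \<noteq> 0" for x :: "real ^ 'n::_"
    proof -
      have "(\<Sum>i\<in>UNIV. (sgn x $ i)\<^sup>2) = (norm (sgn x))\<^sup>2"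
        unfolding norm_vec_def L2_set_def by (simp add: sum_nonneg)
      then show ?thesis
        using that by (simp add: norm_sgn)
    qed
    then show "AE x in lborel. (\<Sum>i\<in>UNIV. g (norm (x::real ^ 'n::_)) * (sgn x $ i)\<^sup>2) = g (norm x)"
      using AE_lborel_singleton[of "0 :: real ^ 'n::_"]
      by (auto simp: sum_distrib_left[symmetric] elim!: eventually_mono)
    have "(\<lambda>x::real ^ 'n::_. sgn x $ i) = (\<lambda>x. sgn x \<bullet> axis i 1)" for i
      by (simp add: inner_axis)
    then have [measurable]: "(\<lambda>x::real ^ 'n::_. sgn x $ i) \<in> borel_measurable borel" for i
      by simp
    show "(\<lambda>x::real ^ 'n::_. \<Sum>i\<in>UNIV. g (norm x) * (sgn x $ i)\<^sup>2) \<in> borel_measurable lborel"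
      by measurable
    show "(\<lambda>x::real ^ 'n::_. g (norm x)) \<in> borel_measurable lborel"
      by measurable
  qed
  finally show "(LINT x|lborel. g (norm x) * (\<mu> \<bullet> sgn x)\<^sup>2) =
      (norm \<mu>)\<^sup>2 / CARD('n) * (LINT x|lborel. g (norm (x::real ^ 'n::_)))"
    by (simp add: field_simps)
qed

section \<open>Schwartz decay and integrals on the real line\<close>

lemma integrable_inverse_one_plus_square:
  "integrable lborel (\<lambda>x::real. inverse (1 + x\<^sup>2))"
  using integrable_inverse_1_plus_square
  by (simp add: set_integrable_def einterval_eq_UNIV)

lemma integrable_quadratic_decay:
  fixes f :: "real \<Rightarrow> real"
  assumes f: "f \<in> borel_measurable borel" and bound: "\<And>x. (1 + x\<^sup>2) * \<bar>f x\<bar> \<le> C"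
  shows "integrable lborel f"
proof (rule Bochner_Integration.integrable_bound)
  show "integrable lborel (\<lambda>x. C * inverse (1 + x\<^sup>2))"
    by (intro integrable_mult_right integrable_inverse_one_plus_square)
  have "\<bar>f x\<bar> \<le> \<bar>C * inverse (1 + x\<^sup>2)\<bar>" for x
  proof -
    have "1 + x\<^sup>2 > 0"
      by (simp add: add_pos_nonneg)
    then have "\<bar>f x\<bar> \<le> C * inverse (1 + x\<^sup>2)"
      using bound[of x] by (simp add: field_simps)
    then show ?thesis
      by linarith
  qed
  then show "AE x in lborel. norm (f x) \<le> norm (C * inverse (1 + x\<^sup>2))"
    by simp
qed (use f in simp)

lemma schwartz_borel_measurable:
  assumes "schwartz f"
  shows "f \<in> borel_measurable borel"
proof -
  have "(deriv ^^ 0) f differentiable (at x)" for x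
    using assms unfolding schwartz_def by blast
  then show ?thesis
    by (intro borel_measurable_continuous_onI)
      (simp add: continuous_at_imp_continuous_on differentiable_imp_continuous_within)
qed

lemma schwartz_moment_bounded:
  assumes "schwartz f"
  shows "\<exists>C. \<forall>x. \<bar>x ^ m * f x\<bar> \<le> C"
proof -
  have "bounded (range (\<lambda>x. x ^ m * (deriv ^^ 0) f x))"
    using assms unfolding schwartz_def by blast
  then show ?thesis
    by (auto simp: bounded_iff)
qed

lemma schwartz_moment_integrable:
  assumes "schwartz f"
  shows "integrable lborel (\<lambda>x. x ^ m * f x)"
proof -
  note [measurable] = schwartz_borel_measurable[OF assms]
  obtain C where C: "\<And>x. \<bar>x ^ m * f x\<bar> \<le> C"
    using schwartz_moment_bounded[OF assms, of m] by blast
  obtain D where D: "\<And>x. \<bar>x ^ (m + 2) * f x\<bar> \<le> D"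
    using schwartz_moment_bounded[OF assms, of "m + 2"] by blast
  show ?thesis
  proof (rule integrable_quadratic_decay[where C = "C + D"])
    fix x
    have "x ^ (m + 2) * f x = x\<^sup>2 * (x ^ m * f x)"
      by (simp add: power_add power2_eq_square)
    then have "x\<^sup>2 * \<bar>x ^ m * f x\<bar> \<le> D"
      using D[of x] by (simp only: abs_mult abs_power2)
    then show "(1 + x\<^sup>2) * \<bar>x ^ m * f x\<bar> \<le> C + D"
      using C[of x] by (simp add: distrib_right)
  qed measurable
qed

text \<open>One factor \<open>f x\<close> is bounded; the other leaves an integrable moment.\<close>

lemma schwartz_square_moment_integrable:
  assumes "schwartz f"
  shows "integrable lborel (\<lambda>x. x ^ m * (f x)\<^sup>2)"
proof -
  note [measurable] = schwartz_borel_measurable[OF assms]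
  obtain C where C: "\<And>x. \<bar>x ^ 0 * f x\<bar> \<le> C"
    using schwartz_moment_bounded[OF assms, of 0] by blast
  show ?thesis
  proof (rule Bochner_Integration.integrable_bound)
    show "integrable lborel (\<lambda>x. C * (x ^ m * f x))"
      by (intro integrable_mult_right schwartz_moment_integrable assms)
    have "\<bar>x ^ m * (f x)\<^sup>2\<bar> \<le> \<bar>C * (x ^ m * f x)\<bar>" for x
    proof -
      have "\<bar>f x\<bar> * \<bar>x ^ m * f x\<bar> \<le> \<bar>C\<bar> * \<bar>x ^ m * f x\<bar>"
        using C[of x] by (intro mult_right_mono) auto
      then show ?thesis
        by (simp add: abs_mult power2_eq_square algebra_simps)
    qed
    then show "AE x in lborel. norm (x ^ m * (f x)\<^sup>2) \<le> norm (C * (x ^ m * f x))"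
      by simp
  qed measurable
qed

text \<open>Reflection makes the integral its own negative. This removes the first-order term in the
  expansion of the B^2 integral.\<close>

lemma lborel_integral_odd_eq_0:
  fixes f :: "real \<Rightarrow> real"
  assumes "\<And>x. f (- x) = - f x"
  shows "(LINT x|lborel. f x) = 0"
  using lborel_integral_real_affine[of "-1" f 0] assms by simp

lemma set_integrable_lborel_atLeast:
  fixes f :: "real \<Rightarrow> real"
  assumes "integrable lborel f"
  shows "set_integrable lborel {c..} f"
  unfolding set_integrable_def using assms by (intro integrable_mult_indicator) auto

text \<open>The limit of the A^2 term, as the integrand
  \<open>r\<^sup>2 * (1 / r ^ 3)\<^sup>2\<close> beyond the cutoff is \<open>1 / r ^ 4\<close>. The
  antiderivative is \<open>- (inverse x ^ 3) / 3\<close>, which tends to 0 at infinity.\<close>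

lemma integral_inverse_power4:
  fixes a :: real
  assumes "0 < a"
  shows "(LINT r|lborel. (if a \<le> r then 1 / r ^ 4 else 0)) = 1 / (3 * a ^ 3)"
proof -
  have "(\<integral>\<^sup>+r. ennreal (1 / r ^ 4) * indicator {a..} r \<partial>lborel) =
      ennreal (- ((0::real) ^ 3) / 3 - (- (inverse a ^ 3) / 3))"
  proof (rule nn_integral_FTC_atLeast)
    show "((\<lambda>x. - (inverse x ^ 3) / 3) has_real_derivative 1 / x ^ 4) (at x)" if "a \<le> x" for x
      using that assms
      by (auto intro!: derivative_eq_intros simp: field_simps eval_nat_numeral)
    show "((\<lambda>x::real. - (inverse x ^ 3) / 3) \<longlongrightarrow> - (0 ^ 3) / 3) at_top"
      by (intro tendsto_intros tendsto_inverse_0_at_top filterlim_ident) auto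
  qed auto
  moreover have "ennreal (1 / r ^ 4) * indicator {a..} r = ennreal (if a \<le> r then 1 / r ^ 4 else 0)" for r
    by (simp add: indicator_def)
  ultimately have "(\<integral>\<^sup>+r. ennreal (if a \<le> r then 1 / r ^ 4 else 0) \<partial>lborel) = ennreal (1 / (3 * a ^ 3))"
    by (simp add: field_simps)
  then show ?thesis
    using assms by (subst integral_eq_nn_integral) auto
qed

section \<open>The squared field and the regularized profile \<open>Upsilon\<close>\<close>

text \<open>The vector is \<open>(3 * A - B) * (\<mu> \<bullet> u)\<close> times \<open>u\<close>
  minus \<open>A - B\<close> times \<open>\<mu>\<close>; the coefficient of
  \<open>(\<mu> \<bullet> u)\<^sup>2\<close> is the product \<open>(3 * A - B) * (A + B)\<close>.
  Separating it from the angle-free part prepares the averaging over directions.\<close>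

lemma norm_dipole_combination:
  fixes u \<mu> :: "'a::real_inner"
  assumes "norm u = 1"
  shows "(norm (A *\<^sub>R ((3 * (\<mu> \<bullet> u)) *\<^sub>R u - \<mu>) - B *\<^sub>R ((\<mu> \<bullet> u) *\<^sub>R u - \<mu>)))\<^sup>2 =
    (norm \<mu>)\<^sup>2 * (A\<^sup>2 + B\<^sup>2 - 2 * (A * B)) + (3 * A\<^sup>2 - B\<^sup>2 + 2 * (A * B)) * (\<mu> \<bullet> u)\<^sup>2"
proof -
  have "u \<bullet> u = 1"
    using assms by (simp add: power2_norm_eq_inner[symmetric])
  then show ?thesis
    unfolding power2_norm_eq_inner
    by (simp add: inner_diff_left inner_diff_right inner_commute[of u \<mu>]
        power2_eq_square algebra_simps)
qed

lemma Upsilon_eq_if: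
  "Upsilon \<eta> a \<epsilon> n r = (LINT z|lborel. (if (a - r) / \<epsilon> \<le> z then \<eta> z / (r + \<epsilon> * z) ^ n else 0))"
  unfolding Upsilon_def set_lebesgue_integral_def
  by (intro Bochner_Integration.integral_cong) (auto simp: indicator_def)

lemma Upsilon_borel_measurable:
  assumes [measurable]: "\<eta> \<in> borel_measurable borel"
  shows "Upsilon \<eta> a \<epsilon> n \<in> borel_measurable borel"
proof -
  have "(\<lambda>r. LINT z|lborel. (if (a - r) / \<epsilon> \<le> z then \<eta> z / (r + \<epsilon> * z) ^ n else 0)) \<in> borel_measurable borel"
    by measurable
  then show ?thesis
    by (simp add: Upsilon_eq_if[abs_def])
qed

section \<open>Bounds and limits for \<open>Upsilon\<close>, uniform in the regularization\<close>

locale mollified_dipole =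
  fixes \<eta> :: "real \<Rightarrow> real" and a :: real
  assumes mollifier: "mollifier \<eta>" and a: "0 < a" "a < 1"
begin

lemma schwartz: "schwartz \<eta>" and even: "\<eta> (- z) = \<eta> z"
  and integral_1: "(LINT z|lborel. \<eta> z) = 1"
  using mollifier unfolding mollifier_def by auto

lemma borel[measurable]: "\<eta> \<in> borel_measurable borel"
  by (rule schwartz_borel_measurable[OF schwartz])

lemma integrable: "integrable lborel \<eta>"
  using schwartz_moment_integrable[OF schwartz, of 0] by simp

lemma Upsilon_measurable[measurable]: "Upsilon \<eta> a \<epsilon> n \<in> borel_measurable borel"
  by (intro Upsilon_borel_measurable borel)

text \<open>On the support \<open>y = r + \<epsilon> z \<ge> a\<close> both \<open>\<bar>r\<bar> / y\<close> and \<open>1 / y\<close> are at most \<open>(1 + \<bar>z\<bar>) / a\<close>,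
  so one majorant controls \<open>\<bar>r\<bar>\<^sup>k / y\<^sup>3\<close> for all \<open>k \<le> 3\<close>, uniformly in \<open>\<epsilon> < 1\<close> and \<open>r\<close>.\<close>

definition dominant :: "real \<Rightarrow> real" where
  "dominant z = \<bar>\<eta> z\<bar> * ((1 + \<bar>z\<bar>) / a) ^ 3"

lemma dominant_integrable: "integrable lborel dominant"
proof -
  have "integrable lborel (\<lambda>z. (\<bar>z ^ 0 * \<eta> z\<bar> + 3 * \<bar>z ^ 1 * \<eta> z\<bar> + 3 * \<bar>z ^ 2 * \<eta> z\<bar> + \<bar>z ^ 3 * \<eta> z\<bar>) / a ^ 3)"
    by (intro integrable_divide Bochner_Integration.integrable_add integrable_mult_right
        integrable_abs schwartz_moment_integrable schwartz)
  \<comment> \<open>Binomial expansion of \<open>(1 + w) ^ 3\<close>, used with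
    \<open>w = \<bar>z\<bar>\<close> and \<open>e = \<bar>\<eta> z\<bar>\<close>.\<close>
  moreover have "(w ^ 0 * e + 3 * (w ^ 1 * e) + 3 * (w ^ 2 * e) + w ^ 3 * e) / a ^ 3 = e * ((1 + w) / a) ^ 3"
    for w e :: real
    using a by (simp add: field_simps eval_nat_numeral)
  ultimately show ?thesis
    unfolding dominant_def[abs_def] by (simp only: abs_mult power_abs)
qed

lemma kernel_le_dominant:
  assumes eps: "0 < \<epsilon>" "\<epsilon> < 1" and k: "k \<le> 3" and z: "(a - r) / \<epsilon> \<le> z"
  shows "\<bar>r\<bar> ^ k * \<bar>\<eta> z / (r + \<epsilon> * z) ^ 3\<bar> \<le> dominant z"
proof -
  let ?y = "r + \<epsilon> * z" and ?w = "(1 + \<bar>z\<bar>) / a"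
  have y: "a \<le> ?y"
    using z eps by (simp add: field_simps)
  have w: "1 / a \<le> ?w"
    using a by (simp add: field_simps)
  have "\<bar>r\<bar> \<le> ?y + \<bar>\<epsilon> * z\<bar>"
    using y a by linarith
  also have "\<bar>\<epsilon> * z\<bar> \<le> \<bar>z\<bar>"
    using eps by (simp add: abs_mult mult_left_le_one_le)
  also have "?y + \<bar>z\<bar> \<le> ?y + ?y * (\<bar>z\<bar> / a)"
  proof -
    have "a * (\<bar>z\<bar> / a) \<le> ?y * (\<bar>z\<bar> / a)"
      using y a by (intro mult_right_mono) auto
    then show ?thesis
      using a by simp
  qed
  also have "\<dots> = ?y * (1 + \<bar>z\<bar> / a)"
    by (simp add: algebra_simps)
  \<comment> \<open>Here \<open>a < 1\<close> enters: it gives \<open>1 \<le> 1 / a\<close>, so that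
    a single \<open>?w\<close> serves for both quotients.\<close>
  also have "\<dots> \<le> ?y * ?w"
    using y a by (intro mult_left_mono) (auto simp: field_simps)
  finally have r: "\<bar>r\<bar> / ?y \<le> ?w"
    using y a by (simp add: field_simps)
  have "1 / ?y \<le> 1 / a"
    using y a by (simp add: frac_le)
  then have y_w: "1 / ?y \<le> ?w"
    using w by simp
  \<comment> \<open>Of the three factors \<open>1 / ?y\<close>, \<open>k\<close> are paired with
    \<open>\<bar>r\<bar>\<close> and \<open>3 - k\<close> stand alone; each resulting factor is at
    most \<open>?w\<close>.\<close>
  have "\<bar>r\<bar> ^ k / ?y ^ 3 = (\<bar>r\<bar> / ?y) ^ k * (1 / ?y) ^ (3 - k)"
    using y a k by (simp add: power_divide power_add[symmetric])
  also have "\<dots> \<le> ?w ^ k * ?w ^ (3 - k)"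
    using r y_w y a by (intro mult_mono power_mono) auto
  also have "\<dots> = ?w ^ 3"
    using k by (simp add: power_add[symmetric])
  finally have "\<bar>\<eta> z\<bar> * (\<bar>r\<bar> ^ k / ?y ^ 3) \<le> \<bar>\<eta> z\<bar> * ?w ^ 3"
    by (intro mult_left_mono) auto
  then show ?thesis
    using y a by (simp add: dominant_def abs_mult field_simps)
qed

definition K :: real where "K = (LINT z|lborel. dominant z)"

text \<open>\<open>K\<close> depends on neither \<open>r\<close> nor \<open>\<epsilon>\<close>. The
  exponents 1 and 2 give the decay in \<open>r\<close> that makes the A^2 integral converge; the
  exponent 2 also absorbs the weight \<open>r\<^sup>2\<close> of the cross term.\<close>

lemma Upsilon_bound:
  assumes eps: "0 < \<epsilon>" "\<epsilon> < 1" and k: "k \<le> 3"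
  shows "\<bar>r\<bar> ^ k * \<bar>Upsilon \<eta> a \<epsilon> 3 r\<bar> \<le> K"
proof -
  let ?f = "\<lambda>z. if (a - r) / \<epsilon> \<le> z then \<eta> z / (r + \<epsilon> * z) ^ 3 else 0"
  have dom: "\<bar>r\<bar> ^ k * \<bar>?f z\<bar> \<le> dominant z" for z
    using kernel_le_dominant[OF eps k, of r z] a by (auto simp: dominant_def)
  have "\<bar>r\<bar> ^ k * \<bar>Upsilon \<eta> a \<epsilon> 3 r\<bar> = \<bar>LINT z|lborel. \<bar>r\<bar> ^ k * ?f z\<bar>"
    by (simp add: Upsilon_eq_if abs_mult)
  also have "\<dots> \<le> K"
    unfolding K_def
  proof (rule integral_abs_bound[THEN order_trans], rule integral_mono)
    have "integrable lborel (\<lambda>z. \<bar>r\<bar> ^ k * ?f z)"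
    proof (rule Bochner_Integration.integrable_bound[OF dominant_integrable])
      show "AE z in lborel. norm (\<bar>r\<bar> ^ k * ?f z) \<le> norm (dominant z)"
        by (intro AE_I2) (simp only: real_norm_def abs_mult power_abs abs_idempotent
            order_trans[OF dom abs_ge_self])
    qed measurable
    then show "integrable lborel (\<lambda>z. \<bar>\<bar>r\<bar> ^ k * ?f z\<bar>)"
      by (rule integrable_abs)
    show "\<bar>\<bar>r\<bar> ^ k * ?f z\<bar> \<le> dominant z" for z
      using dom[of z] by (simp only: abs_mult power_abs abs_idempotent)
  qed (rule dominant_integrable)
  finally show ?thesis .
qed

lemma K_nonneg: "0 \<le> K"
  unfolding K_def dominant_def using a by (intro integral_nonneg_AE) auto

text \<open>The point \<open>r n\<close> may move with \<open>n\<close>: the majorant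
  \<open>dominant\<close> involves neither \<open>r n\<close> nor \<open>\<epsilon> n\<close>. A
  fixed \<open>r\<close> gives the sharp cutoff off \<open>a\<close>;
  \<open>r n = a + \<epsilon> n * w\<close> gives the profile inside the boundary layer.\<close>

lemma Upsilon_tendsto:
  assumes eps: "\<And>n. 0 < \<epsilon> n" "\<And>n. \<epsilon> n < (1::real)"
    and f[measurable]: "f \<in> borel_measurable borel"
    and lim: "\<And>z. (\<lambda>n. if a \<le> r n + \<epsilon> n * z then 1 / (r n + \<epsilon> n * z) ^ 3 else 0) \<longlonglongrightarrow> f z"
  shows "(\<lambda>n. Upsilon \<eta> a (\<epsilon> n) 3 (r n)) \<longlonglongrightarrow> (LINT z|lborel. \<eta> z * f z)"
  unfolding Upsilon_eq_if
proof (rule integral_dominated_convergence[where w = dominant])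
  have iff: "(a - r n) / \<epsilon> n \<le> z \<longleftrightarrow> a \<le> r n + \<epsilon> n * z" for n z
    using eps(1)[of n] by (simp add: field_simps)
  have "(\<lambda>n. if (a - r n) / \<epsilon> n \<le> z then \<eta> z / (r n + \<epsilon> n * z) ^ 3 else 0) \<longlonglongrightarrow> \<eta> z * f z" for z
  proof -
    have "(\<lambda>n. \<eta> z * (if a \<le> r n + \<epsilon> n * z then 1 / (r n + \<epsilon> n * z) ^ 3 else 0)) \<longlonglongrightarrow> \<eta> z * f z"
      by (intro tendsto_intros lim)
    then show ?thesis
      by (simp add: if_distrib iff cong: if_cong)
  qed
  then show "AE z in lborel. (\<lambda>n. if (a - r n) / \<epsilon> n \<le> z then \<eta> z / (r n + \<epsilon> n * z) ^ 3 else 0) \<longlonglongrightarrow> \<eta> z * f z"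
    by simp
  show "AE z in lborel. norm (if (a - r n) / \<epsilon> n \<le> z then \<eta> z / (r n + \<epsilon> n * z) ^ 3 else 0) \<le> dominant z" for n
    using kernel_le_dominant[OF eps(1)[of n] eps(2)[of n], of 0 "r n"] a
    by (auto simp: dominant_def)
  show "(\<lambda>z. if (a - r n) / \<epsilon> n \<le> z then \<eta> z / (r n + \<epsilon> n * z) ^ 3 else 0) \<in> borel_measurable lborel" for n
    by measurable
  show "(\<lambda>z. \<eta> z * f z) \<in> borel_measurable lborel"
    by measurable
qed (rule dominant_integrable)

section \<open>Integrability of the three radial integrands\<close>

lemma Upsilon'_measurable[measurable]: "Upsilon' \<eta> a \<epsilon> n \<in> borel_measurable borel"
  unfolding Upsilon'_def by measurable

text \<open>The squared bounds for the exponents 1 and 2 are added, whence the factor 2 and the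
  weight \<open>1 + r\<^sup>2\<close>.\<close>

lemma Upsilon_square_bound:
  assumes "0 < \<epsilon>" "\<epsilon> < 1"
  shows "r\<^sup>2 * (Upsilon \<eta> a \<epsilon> 3 r)\<^sup>2 \<le> 2 * K\<^sup>2 * inverse (1 + r\<^sup>2)"
proof -
  let ?A = "Upsilon \<eta> a \<epsilon> 3 r"
  have "(\<bar>r\<bar> ^ 1 * \<bar>?A\<bar>)\<^sup>2 \<le> K\<^sup>2" "(\<bar>r\<bar> ^ 2 * \<bar>?A\<bar>)\<^sup>2 \<le> K\<^sup>2"
    using Upsilon_bound[OF assms, of 1 r] Upsilon_bound[OF assms, of 2 r]
    by (intro power_mono; simp)+
  then have "(1 + r\<^sup>2) * (r\<^sup>2 * ?A\<^sup>2) \<le> 2 * K\<^sup>2"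
    by (simp add: power_mult_distrib algebra_simps power2_eq_square)
  moreover have "0 < 1 + r\<^sup>2"
    by (simp add: add_pos_nonneg)
  ultimately show ?thesis
    by (simp add: field_simps)
qed

lemma Upsilon_square_integrable:
  assumes "0 < \<epsilon>" "\<epsilon> < 1"
  shows "integrable lborel (\<lambda>r. r\<^sup>2 * (Upsilon \<eta> a \<epsilon> 3 r)\<^sup>2)"
proof (rule Bochner_Integration.integrable_bound)
  show "integrable lborel (\<lambda>r. 2 * K\<^sup>2 * inverse (1 + r\<^sup>2))"
    by (intro integrable_mult_right integrable_inverse_one_plus_square)
  show "AE r in lborel. norm (r\<^sup>2 * (Upsilon \<eta> a \<epsilon> 3 r)\<^sup>2) \<le> norm (2 * K\<^sup>2 * inverse (1 + r\<^sup>2))"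
    using Upsilon_square_bound[OF assms] by (auto intro!: order_trans[OF _ abs_ge_self])
qed measurable

lemma Upsilon'_integrable:
  assumes "0 < \<epsilon>"
  shows "integrable lborel (Upsilon' \<eta> a \<epsilon> n)"
proof -
  have "integrable lborel (\<lambda>r. \<eta> (a / \<epsilon> + (- 1 / \<epsilon>) * r))"
    using assms by (intro lborel_integrable_real_affine integrable) auto
  then have "integrable lborel (\<lambda>r. \<eta> ((a - r) / \<epsilon>))"
    by (simp add: diff_divide_distrib)
  then show ?thesis
    unfolding Upsilon'_def[abs_def] by (rule integrable_mult_right)
qed

text \<open>Substituting \<open>r = a - \<epsilon> * w\<close> makes the weight
  \<open>r\<^sup>2\<close> a quadratic polynomial in \<open>w\<close>, so only moments of the square
  of \<open>\<eta>\<close> remain.\<close>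

lemma Upsilon'_square_integrable:
  assumes "0 < \<epsilon>"
  shows "integrable lborel (\<lambda>r. r\<^sup>2 * (Upsilon' \<eta> a \<epsilon> 2 r)\<^sup>2)"
proof -
  let ?f = "\<lambda>w. a\<^sup>2 * (w ^ 0 * (\<eta> w)\<^sup>2) - 2 * a * \<epsilon> * (w ^ 1 * (\<eta> w)\<^sup>2) + \<epsilon>\<^sup>2 * (w ^ 2 * (\<eta> w)\<^sup>2)"
  have "integrable lborel ?f"
    by (intro Bochner_Integration.integrable_add Bochner_Integration.integrable_diff
        integrable_mult_right schwartz_square_moment_integrable schwartz)
  then have "integrable lborel (\<lambda>r. ?f (a / \<epsilon> + (- 1 / \<epsilon>) * r))"
    using assms by (intro lborel_integrable_real_affine) auto
  then have int: "integrable lborel (\<lambda>r. (1 / (a\<^sup>2 * \<epsilon>))\<^sup>2 * ?f (a / \<epsilon> + (- 1 / \<epsilon>) * r))"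
    by (rule integrable_mult_right)
  have eq: "(1 / (a\<^sup>2 * \<epsilon>))\<^sup>2 * ?f (a / \<epsilon> + (- 1 / \<epsilon>) * r) = r\<^sup>2 * (Upsilon' \<eta> a \<epsilon> 2 r)\<^sup>2" for r
  proof -
    define w where "w = (a - r) / \<epsilon>"
    have w: "a / \<epsilon> + (- 1 / \<epsilon>) * r = w" and r: "r = a - \<epsilon> * w"
      using assms by (simp_all add: w_def field_simps)
    have "?f w = (a - \<epsilon> * w)\<^sup>2 * (\<eta> w)\<^sup>2"
      by (simp add: power2_eq_square algebra_simps)
    then show ?thesis
      unfolding Upsilon'_def w w_def[symmetric] using r by (simp only: power_mult_distrib) simp
  qed
  show ?thesis
    using int unfolding eq .
qed

lemma Upsilon_mult_Upsilon'_integrable: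
  assumes "0 < \<epsilon>" "\<epsilon> < 1"
  shows "integrable lborel (\<lambda>r. r\<^sup>2 * (Upsilon \<eta> a \<epsilon> 3 r * Upsilon' \<eta> a \<epsilon> 2 r))"
proof (rule Bochner_Integration.integrable_bound)
  show "integrable lborel (\<lambda>r. K * Upsilon' \<eta> a \<epsilon> 2 r)"
    using assms by (intro integrable_mult_right Upsilon'_integrable)
  show "AE r in lborel. norm (r\<^sup>2 * (Upsilon \<eta> a \<epsilon> 3 r * Upsilon' \<eta> a \<epsilon> 2 r)) \<le> norm (K * Upsilon' \<eta> a \<epsilon> 2 r)"
    using mult_right_mono[OF Upsilon_bound[OF assms, of 2] abs_ge_zero] K_nonneg
    by (simp add: abs_mult mult.assoc)
qed measurable

section \<open>Reduction of the energy to radial integrals\<close>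

lemma U_mag_eq_radial_integrals:
  assumes eps: "0 < \<epsilon>" "\<epsilon> < 1"
  shows "U_mag \<eta> \<mu> a \<epsilon> = (norm \<mu>)\<^sup>2 *
    ((LINT r:{0..}|lborel. r\<^sup>2 * (Upsilon \<eta> a \<epsilon> 3 r)\<^sup>2)
      + (LINT r:{0..}|lborel. r\<^sup>2 * (Upsilon' \<eta> a \<epsilon> 2 r)\<^sup>2) / 3
      - 2 / 3 * (LINT r:{0..}|lborel. r\<^sup>2 * (Upsilon \<eta> a \<epsilon> 3 r * Upsilon' \<eta> a \<epsilon> 2 r)))"
    (is "_ = _ * (?AA + ?BB / 3 - 2 / 3 * ?AB)")
proof -
  define A where "A = Upsilon \<eta> a \<epsilon> 3"
  define B where "B = Upsilon' \<eta> a \<epsilon> 2"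
  define P where "P r = (norm \<mu>)\<^sup>2 * ((A r)\<^sup>2 + (B r)\<^sup>2 - 2 * (A r * B r))" for r
  define Q where "Q r = 3 * (A r)\<^sup>2 - (B r)\<^sup>2 + 2 * (A r * B r)" for r
  have [measurable]: "A \<in> borel_measurable borel" "B \<in> borel_measurable borel"
    unfolding A_def B_def by measurable
  have [measurable]: "P \<in> borel_measurable borel" "Q \<in> borel_measurable borel"
    unfolding P_def[abs_def] Q_def[abs_def] by measurable
  have AA: "set_integrable lborel {0..} (\<lambda>r. r\<^sup>2 * (A r)\<^sup>2)"
    and BB: "set_integrable lborel {0..} (\<lambda>r. r\<^sup>2 * (B r)\<^sup>2)"
    and AB: "set_integrable lborel {0..} (\<lambda>r. r\<^sup>2 * (A r * B r))"
    unfolding A_def B_def using eps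
    by (intro set_integrable_lborel_atLeast Upsilon_square_integrable
        Upsilon'_square_integrable Upsilon_mult_Upsilon'_integrable; simp)+
  have P_eq: "r\<^sup>2 * P r = (norm \<mu>)\<^sup>2 * (r\<^sup>2 * (A r)\<^sup>2 + r\<^sup>2 * (B r)\<^sup>2 - 2 * (r\<^sup>2 * (A r * B r)))"
    and Q_eq: "r\<^sup>2 * Q r = 3 * (r\<^sup>2 * (A r)\<^sup>2) - r\<^sup>2 * (B r)\<^sup>2 + 2 * (r\<^sup>2 * (A r * B r))" for r
    unfolding P_def Q_def by (simp_all add: algebra_simps)
  have P_int: "set_integrable lborel {0..} (\<lambda>r. r\<^sup>2 * P r)"
    and Q_int: "set_integrable lborel {0..} (\<lambda>r. r\<^sup>2 * Q r)"
    unfolding P_eq Q_eq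
    by (intro set_integral_add set_integral_diff set_integrable_mult_right AA BB AB)+
  have P_val: "(LINT r:{0..}|lborel. r\<^sup>2 * P r) = (norm \<mu>)\<^sup>2 * (?AA + ?BB - 2 * ?AB)"
    and Q_val: "(LINT r:{0..}|lborel. r\<^sup>2 * Q r) = 3 * ?AA - ?BB + 2 * ?AB"
    unfolding P_eq Q_eq A_def[symmetric] B_def[symmetric]
    using AA BB AB by (simp_all add: set_integral_add set_integral_diff)
  have P3: "integrable lborel (\<lambda>x::real ^ 3. P (norm x))"
    and Q3: "integrable lborel (\<lambda>x::real ^ 3. Q (norm x))"
    using P_int Q_int by (auto intro!: lborel_integrable_radial)
  have P3_val: "(LINT x|lborel. P (norm (x::real ^ 3))) = 4 * pi * ((norm \<mu>)\<^sup>2 * (?AA + ?BB - 2 * ?AB))"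
    and Q3_val: "(LINT x|lborel. Q (norm (x::real ^ 3))) = 4 * pi * (3 * ?AA - ?BB + 2 * ?AB)"
    unfolding P_val[symmetric] Q_val[symmetric]
    by (simp_all add: lborel_integral_radial unit_ball_vol_3)
  have "(LINT x|lborel. (norm (dipole_field \<eta> \<mu> a \<epsilon> x))\<^sup>2) =
      (LINT x|lborel. P (norm x) + Q (norm x) * (\<mu> \<bullet> sgn x)\<^sup>2)"
  proof (rule integral_cong_AE)
    show "AE x in lborel. (norm (dipole_field \<eta> \<mu> a \<epsilon> x))\<^sup>2 = P (norm x) + Q (norm x) * (\<mu> \<bullet> sgn x)\<^sup>2"
      using AE_lborel_singleton[of "0 :: real ^ 3"]
    proof eventually_elim
      case (elim x)
      then have "norm (sgn x) = 1"
        by (simp add: norm_sgn)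
      then show ?case
        unfolding dipole_field_def Let_def P_def Q_def A_def B_def
        by (rule norm_dipole_combination)
    qed
    have [measurable]: "(sgn :: real ^ 3 \<Rightarrow> _) \<in> borel_measurable borel"
      unfolding sgn_div_norm[abs_def] by measurable
    show "(\<lambda>x. (norm (dipole_field \<eta> \<mu> a \<epsilon> x))\<^sup>2) \<in> borel_measurable lborel"
      unfolding dipole_field_def Let_def by measurable
    show "(\<lambda>x. P (norm x) + Q (norm x) * (\<mu> \<bullet> sgn x)\<^sup>2) \<in> borel_measurable lborel"
      by measurable
  qed
  also have "\<dots> = (LINT x|lborel. P (norm (x::real ^ 3))) +
      (norm \<mu>)\<^sup>2 / 3 * (LINT x|lborel. Q (norm (x::real ^ 3)))"
    using P3 Q3 by (simp add: lborel_integral_radial_inner_sgn)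
  \<comment> \<open>The sphere area gives \<open>4 * pi\<close>; the other factor 2 arises because
    averaging turns A^2 + B^2 - 2AB plus a third of 3A^2 - B^2 + 2AB into 2(A^2 + B^2/3 - 2AB/3).
    Together they cancel the prefactor of the energy.\<close>
  also have "\<dots> = 8 * pi * ((norm \<mu>)\<^sup>2 * (?AA + ?BB / 3 - 2 / 3 * ?AB))"
    unfolding P3_val Q3_val by (simp add: algebra_simps)
  finally show ?thesis
    unfolding U_mag_def by simp
qed

section \<open>Limit of the A^2 term\<close>

text \<open>Dominated convergence at two levels: in \<open>z\<close> inside \<open>Upsilon\<close>
  for each fixed \<open>r\<close>, then in \<open>r\<close> with the majorant from
  \<open>Upsilon_square_bound\<close>.\<close>

lemma Upsilon_square_tendsto:
  assumes eps: "\<And>n. 0 < \<epsilon> n" "\<And>n. \<epsilon> n < (1::real)" "\<epsilon> \<longlonglongrightarrow> 0"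
  shows "(\<lambda>n. LINT r:{0..}|lborel. r\<^sup>2 * (Upsilon \<eta> a (\<epsilon> n) 3 r)\<^sup>2) \<longlonglongrightarrow> 1 / (3 * a ^ 3)"
  unfolding integral_inverse_power4[OF a(1), symmetric] set_lebesgue_integral_def
proof (rule integral_dominated_convergence)
  show "integrable lborel (\<lambda>r. 2 * K\<^sup>2 * inverse (1 + r\<^sup>2))"
    by (intro integrable_mult_right integrable_inverse_one_plus_square)
  show "AE r in lborel. norm (indicator {0..} r *\<^sub>R (r\<^sup>2 * (Upsilon \<eta> a (\<epsilon> n) 3 r)\<^sup>2)) \<le> 2 * K\<^sup>2 * inverse (1 + r\<^sup>2)" for n
    using Upsilon_square_bound[OF eps(1)[of n] eps(2)[of n]] by (auto simp: indicator_def)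
  show "AE r in lborel. (\<lambda>n. indicator {0..} r *\<^sub>R (r\<^sup>2 * (Upsilon \<eta> a (\<epsilon> n) 3 r)\<^sup>2)) \<longlonglongrightarrow>
      (if a \<le> r then 1 / r ^ 4 else 0)"
    \<comment> \<open>At \<open>r = a\<close> itself \<open>Upsilon\<close> tends to half the jump,
      not to \<open>1 / a ^ 3\<close>; this one point is discarded.\<close>
    using AE_lborel_singleton[of a]
  proof eventually_elim
    case (elim r)
    have arg: "(\<lambda>n. r + \<epsilon> n * z) \<longlonglongrightarrow> r" for z
      using tendsto_add[OF tendsto_const tendsto_mult_left_zero[OF eps(3)]] by simp
    show ?case
    proof (cases "a < r")
      case True
      \<comment> \<open>Each fixed \<open>z\<close> eventually satisfies the cutoff condition, so in
        the limit the whole unit mass of \<open>\<eta>\<close> counts.\<close>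
      have "(\<lambda>n. Upsilon \<eta> a (\<epsilon> n) 3 r) \<longlonglongrightarrow> (LINT z|lborel. \<eta> z * (1 / r ^ 3))"
      proof (rule Upsilon_tendsto[OF eps(1,2)])
        fix z
        have "\<forall>\<^sub>F n in sequentially. a < r + \<epsilon> n * z"
          using arg True by (rule order_tendstoD)
        then have "\<forall>\<^sub>F n in sequentially. 1 / (r + \<epsilon> n * z) ^ 3 =
            (if a \<le> r + \<epsilon> n * z then 1 / (r + \<epsilon> n * z) ^ 3 else 0)"
          by eventually_elim simp
        moreover have "(\<lambda>n. 1 / (r + \<epsilon> n * z) ^ 3) \<longlonglongrightarrow> 1 / r ^ 3"
          using True a by (intro tendsto_intros arg) auto
        ultimately show "(\<lambda>n. if a \<le> r + \<epsilon> n * z then 1 / (r + \<epsilon> n * z) ^ 3 else 0) \<longlonglongrightarrow> 1 / r ^ 3"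
          by (rule Lim_transform_eventually[rotated])
      qed simp
      then have "(\<lambda>n. Upsilon \<eta> a (\<epsilon> n) 3 r) \<longlonglongrightarrow> 1 / r ^ 3"
        by (simp add: integral_1)
      then have "(\<lambda>n. indicator {0..} r *\<^sub>R (r\<^sup>2 * (Upsilon \<eta> a (\<epsilon> n) 3 r)\<^sup>2)) \<longlonglongrightarrow>
          indicator {0..} r *\<^sub>R (r\<^sup>2 * (1 / r ^ 3)\<^sup>2)"
        by (intro tendsto_intros)
      then show ?thesis
        using True a by (simp add: field_simps eval_nat_numeral)
    next
      case False
      with elim have "r < a"
        by simp
      have "(\<lambda>n. Upsilon \<eta> a (\<epsilon> n) 3 r) \<longlonglongrightarrow> (LINT z|lborel. \<eta> z * 0)"
      proof (rule Upsilon_tendsto[OF eps(1,2)])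
        fix z
        have "\<forall>\<^sub>F n in sequentially. r + \<epsilon> n * z < a"
          using arg \<open>r < a\<close> by (rule order_tendstoD)
        then show "(\<lambda>n. if a \<le> r + \<epsilon> n * z then 1 / (r + \<epsilon> n * z) ^ 3 else 0) \<longlonglongrightarrow> 0"
          by (intro tendsto_eventually) (auto elim: eventually_mono)
      qed simp
      then have "(\<lambda>n. indicator {0..} r *\<^sub>R (r\<^sup>2 * (Upsilon \<eta> a (\<epsilon> n) 3 r)\<^sup>2)) \<longlonglongrightarrow>
          indicator {0..} r *\<^sub>R (r\<^sup>2 * 0\<^sup>2)"
        by (intro tendsto_intros) simp
      then show ?thesis
        using \<open>r < a\<close> by simp
    qed
  qed
  show "(\<lambda>r. if a \<le> r then 1 / r ^ 4 else 0) \<in> borel_measurable lborel"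
    by measurable
  show "(\<lambda>r. indicator {0..} r *\<^sub>R (r\<^sup>2 * (Upsilon \<eta> a (\<epsilon> n) 3 r)\<^sup>2)) \<in> borel_measurable lborel" for n
    by measurable
qed

section \<open>Limit of the cross term\<close>

text \<open>The function G of the overview. By evenness it is also the integral of
  \<open>\<eta>\<close> up to \<open>w\<close>, a smoothed Heaviside step: the limiting shape of
  \<open>a ^ 3 * Upsilon \<eta> a \<epsilon> 3 r\<close> in the layer
  \<open>r = a + \<epsilon> * w\<close>.\<close>

definition tail :: "real \<Rightarrow> real" where
  "tail w = (LINT z|lborel. (if - w \<le> z then \<eta> z else 0))"

lemma tail_integrable: "integrable lborel (\<lambda>z. if w \<le> z then \<eta> z else 0)"
  by (rule Bochner_Integration.integrable_bound[OF integrable]) auto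

text \<open>Reflection turns \<open>tail (- w)\<close> into the integral over
  \<open>z \<le> - w\<close>, complementary to that over \<open>z \<ge> - w\<close> up to the shared
  endpoint.\<close>

lemma tail_add_tail_uminus: "tail w + tail (- w) = 1"
proof -
  have "tail (- w) = (LINT z|lborel. (if w \<le> - z then \<eta> z else 0))"
    unfolding tail_def using lborel_integral_real_affine[of "-1" "\<lambda>z. if w \<le> z then \<eta> z else 0" 0]
    by (simp add: even cong: if_cong)
  moreover have "integrable lborel (\<lambda>z. if w \<le> - z then \<eta> z else 0)"
    by (rule Bochner_Integration.integrable_bound[OF integrable]) auto
  ultimately have "tail w + tail (- w) =
      (LINT z|lborel. (if - w \<le> z then \<eta> z else 0) + (if w \<le> - z then \<eta> z else 0))"
    unfolding tail_def using tail_integrable[of "- w"] by simp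
  also have "\<dots> = (LINT z|lborel. \<eta> z)"
  proof (rule integral_cong_AE)
    show "AE z in lborel. (if - w \<le> z then \<eta> z else 0) + (if w \<le> - z then \<eta> z else 0) = \<eta> z"
      using AE_lborel_singleton[of "- w"] by eventually_elim auto
    show "(\<lambda>z. (if - w \<le> z then \<eta> z else 0) + (if w \<le> - z then \<eta> z else 0)) \<in> borel_measurable lborel"
      by measurable
  qed simp
  finally show ?thesis
    by (simp add: integral_1)
qed

lemma tail_measurable[measurable]: "tail \<in> borel_measurable borel"
proof -
  have "(\<lambda>w. LINT z|lborel. (if - w \<le> z then \<eta> z else 0)) \<in> borel_measurable borel"
    by measurable
  then show ?thesis
    by (simp add: tail_def[abs_def])
qed

text \<open>As \<open>\<eta>\<close> is the derivative of \<open>tail\<close>, which climbs from 0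
  to 1, this is half the increment of its square. Averaging over \<open>w\<close> and
  \<open>- w\<close> gives the same value without differentiating.\<close>

lemma integral_mult_tail: "(LINT w|lborel. \<eta> w * tail w) = 1 / 2"
proof -
  let ?C = "LINT z|lborel. \<bar>\<eta> z\<bar>"
  have bound: "\<bar>tail w\<bar> \<le> ?C" for w
    unfolding tail_def
    by (rule integral_abs_bound[THEN order_trans], rule integral_mono)
      (auto intro!: integrable_abs integrable tail_integrable)
  have int: "integrable lborel (\<lambda>w. \<eta> w * tail w)"
  proof (rule Bochner_Integration.integrable_bound)
    show "integrable lborel (\<lambda>w. ?C * \<bar>\<eta> w\<bar>)"
      by (intro integrable_mult_right integrable_abs integrable)
    show "AE w in lborel. norm (\<eta> w * tail w) \<le> norm (?C * \<bar>\<eta> w\<bar>)"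
      using mult_right_mono[OF bound abs_ge_zero]
      by (auto simp: abs_mult mult.commute intro!: order_trans[OF _ abs_ge_self])
  qed measurable
  have refl: "(LINT w|lborel. \<eta> w * tail w) = (LINT w|lborel. \<eta> w * tail (- w))"
    using lborel_integral_real_affine[of "-1" "\<lambda>w. \<eta> w * tail w" 0] by (simp add: even)
  have int': "integrable lborel (\<lambda>w. \<eta> w * tail (- w))"
    using lborel_integrable_real_affine[OF int, of "-1" 0] by (simp add: even)
  have "2 * (LINT w|lborel. \<eta> w * tail w) = (LINT w|lborel. \<eta> w * tail w) + (LINT w|lborel. \<eta> w * tail (- w))"
    using refl by simp
  also have "\<dots> = (LINT w|lborel. \<eta> w * (tail w + tail (- w)))"
    using int int' by (simp add: distrib_left)
  also have "\<dots> = 1"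
    by (simp add: tail_add_tail_uminus integral_1)
  finally show ?thesis
    by simp
qed

lemma Upsilon_mult_Upsilon'_tendsto:
  assumes eps: "\<And>n. 0 < \<epsilon> n" "\<And>n. \<epsilon> n < (1::real)" "\<epsilon> \<longlonglongrightarrow> 0"
  shows "(\<lambda>n. LINT r:{0..}|lborel. r\<^sup>2 * (Upsilon \<eta> a (\<epsilon> n) 3 r * Upsilon' \<eta> a (\<epsilon> n) 2 r))
    \<longlonglongrightarrow> 1 / (2 * a ^ 3)"
proof -
  let ?r = "\<lambda>n w. a + \<epsilon> n * w"
  \<comment> \<open>The Jacobian \<open>\<epsilon> n\<close> has cancelled the
    \<open>1 / \<epsilon> n\<close> in \<open>Upsilon'\<close>, and evenness has replaced
    \<open>\<eta> (- w)\<close> by \<open>\<eta> w\<close>.\<close>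
  let ?s = "\<lambda>n w. indicator {0..} (?r n w) * ((?r n w)\<^sup>2 * Upsilon \<eta> a (\<epsilon> n) 3 (?r n w) * \<eta> w / a\<^sup>2)"
  have subst: "(LINT r:{0..}|lborel. r\<^sup>2 * (Upsilon \<eta> a (\<epsilon> n) 3 r * Upsilon' \<eta> a (\<epsilon> n) 2 r)) =
      (LINT w|lborel. ?s n w)" for n
  proof -
    have "(LINT r:{0..}|lborel. r\<^sup>2 * (Upsilon \<eta> a (\<epsilon> n) 3 r * Upsilon' \<eta> a (\<epsilon> n) 2 r)) =
        (LINT w|lborel. \<epsilon> n * (indicator {0..} (?r n w) *
          ((?r n w)\<^sup>2 * (Upsilon \<eta> a (\<epsilon> n) 3 (?r n w) * Upsilon' \<eta> a (\<epsilon> n) 2 (?r n w)))))"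
      unfolding set_lebesgue_integral_def using eps(1)[of n]
      by (subst lborel_integral_real_affine[where c = "\<epsilon> n" and t = a]) auto
    also have "\<dots> = (LINT w|lborel. ?s n w)"
      using eps(1)[of n] by (intro Bochner_Integration.integral_cong) (auto simp: Upsilon'_def even)
    finally show ?thesis .
  qed
  have "(\<lambda>n. LINT w|lborel. ?s n w) \<longlonglongrightarrow> (LINT w|lborel. \<eta> w * tail w / a ^ 3)"
  proof (rule integral_dominated_convergence)
    show "integrable lborel (\<lambda>w. K / a\<^sup>2 * \<bar>\<eta> w\<bar>)"
      by (intro integrable_mult_right integrable_abs integrable)
    have "\<bar>?s n w\<bar> \<le> K / a\<^sup>2 * \<bar>\<eta> w\<bar>" for n w
    proof -
      have "\<bar>?s n w\<bar> \<le> (\<bar>?r n w\<bar> ^ 2 * \<bar>Upsilon \<eta> a (\<epsilon> n) 3 (?r n w)\<bar>) * (\<bar>\<eta> w\<bar> / a\<^sup>2)"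
        by (simp add: abs_mult indicator_def)
      also have "\<dots> \<le> K * (\<bar>\<eta> w\<bar> / a\<^sup>2)"
        by (intro mult_right_mono Upsilon_bound eps) auto
      finally show ?thesis
        by simp
    qed
    then show "AE w in lborel. norm (?s n w) \<le> K / a\<^sup>2 * \<bar>\<eta> w\<bar>" for n
      by simp
    have "(\<lambda>n. ?s n w) \<longlonglongrightarrow> \<eta> w * tail w / a ^ 3" for w
    proof -
      have r: "(\<lambda>n. a + \<epsilon> n * z) \<longlonglongrightarrow> a" for z
        using tendsto_add[OF tendsto_const tendsto_mult_left_zero[OF eps(3)]] by simp
      have "(\<lambda>n. Upsilon \<eta> a (\<epsilon> n) 3 (?r n w)) \<longlonglongrightarrow>
          (LINT z|lborel. \<eta> z * (if - w \<le> z then 1 / a ^ 3 else 0))"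
      proof (rule Upsilon_tendsto[OF eps(1,2)])
        fix z
        have arg: "?r n w + \<epsilon> n * z = a + \<epsilon> n * (w + z)" for n
          by (simp add: algebra_simps)
        \<comment> \<open>In the rescaled variables the cutoff no longer depends on
          \<open>n\<close>; this is why a proper fraction of the mass survives.\<close>
        have iff: "a \<le> ?r n w + \<epsilon> n * z \<longleftrightarrow> - w \<le> z" for n
          unfolding arg using eps(1)[of n] by (auto simp: zero_le_mult_iff)
        have "(\<lambda>n. 1 / (a + \<epsilon> n * (w + z)) ^ 3) \<longlonglongrightarrow> 1 / a ^ 3"
          using a by (intro tendsto_intros r) auto
        then show "(\<lambda>n. if a \<le> ?r n w + \<epsilon> n * z then 1 / (?r n w + \<epsilon> n * z) ^ 3 else 0)
            \<longlonglongrightarrow> (if - w \<le> z then 1 / a ^ 3 else 0)"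
          unfolding iff unfolding arg by auto
      qed measurable
      also have "(LINT z|lborel. \<eta> z * (if - w \<le> z then 1 / a ^ 3 else 0)) =
          (LINT z|lborel. (if - w \<le> z then \<eta> z else 0) / a ^ 3)"
        by (intro Bochner_Integration.integral_cong) auto
      also have "\<dots> = tail w / a ^ 3"
        by (simp add: tail_def)
      finally have "(\<lambda>n. (?r n w)\<^sup>2 * Upsilon \<eta> a (\<epsilon> n) 3 (?r n w) * \<eta> w / a\<^sup>2) \<longlonglongrightarrow>
          a\<^sup>2 * (tail w / a ^ 3) * \<eta> w / a\<^sup>2"
        using a by (intro tendsto_intros r) auto
      also have "a\<^sup>2 * (tail w / a ^ 3) * \<eta> w / a\<^sup>2 = \<eta> w * tail w / a ^ 3"
        using a by (simp add: field_simps eval_nat_numeral)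
      finally have lim: "(\<lambda>n. (?r n w)\<^sup>2 * Upsilon \<eta> a (\<epsilon> n) 3 (?r n w) * \<eta> w / a\<^sup>2) \<longlonglongrightarrow>
          \<eta> w * tail w / a ^ 3" .
      \<comment> \<open>For fixed \<open>w\<close> the restriction to \<open>r \<ge> 0\<close>
        eventually holds, because \<open>a > 0\<close>.\<close>
      have "\<forall>\<^sub>F n in sequentially. 0 < ?r n w"
        using r a(1) by (rule order_tendstoD)
      then have "\<forall>\<^sub>F n in sequentially. (?r n w)\<^sup>2 * Upsilon \<eta> a (\<epsilon> n) 3 (?r n w) * \<eta> w / a\<^sup>2 = ?s n w"
        by eventually_elim simp
      with lim show ?thesis
        by (rule Lim_transform_eventually)
    qed
    then show "AE w in lborel. (\<lambda>n. ?s n w) \<longlonglongrightarrow> \<eta> w * tail w / a ^ 3"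
      by simp
    show "?s n \<in> borel_measurable lborel" for n
      by measurable
    show "(\<lambda>w. \<eta> w * tail w / a ^ 3) \<in> borel_measurable lborel"
      by measurable
  qed
  also have "(LINT w|lborel. \<eta> w * tail w / a ^ 3) = 1 / (2 * a ^ 3)"
    by (simp add: integral_mult_tail)
  finally show ?thesis
    by (simp add: subst)
qed

section \<open>Asymptotics of the divergent B^2 term\<close>

text \<open>With \<open>r = a + \<epsilon> * w\<close> the square \<open>r\<^sup>2\<close> has three
  terms: the constant one gives the divergence, the linear one integrates to 0, and the quadratic
  one bounds the error.\<close>

lemma Upsilon'_square_asymp:
  assumes eps: "0 < \<epsilon>"
  shows "\<bar>(LINT r:{0..}|lborel. r\<^sup>2 * (Upsilon' \<eta> a \<epsilon> 2 r)\<^sup>2)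
      - (LINT z|lborel. (\<eta> z)\<^sup>2) / (a\<^sup>2 * \<epsilon>)\<bar> \<le> \<epsilon> * ((LINT z|lborel. z\<^sup>2 * (\<eta> z)\<^sup>2) / a ^ 4)"
proof -
  let ?r = "\<lambda>w. a + \<epsilon> * w"
  let ?f = "\<lambda>w. indicator {0..} (?r w) * ((?r w)\<^sup>2 * (\<eta> w)\<^sup>2)"
  \<comment> \<open>The linear term is subtracted although its integral is 0: only then is the
    remainder pointwise of order \<open>\<epsilon>\<^sup>2\<close>.\<close>
  let ?D = "\<lambda>w. ?f w - (a\<^sup>2 * (\<eta> w)\<^sup>2 + 2 * a * \<epsilon> * (w * (\<eta> w)\<^sup>2))"
  have m: "integrable lborel (\<lambda>w. (\<eta> w)\<^sup>2)" "integrable lborel (\<lambda>w. w * (\<eta> w)\<^sup>2)"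
      "integrable lborel (\<lambda>w. w\<^sup>2 * (\<eta> w)\<^sup>2)"
    using schwartz_square_moment_integrable[OF schwartz, of 0]
      schwartz_square_moment_integrable[OF schwartz, of 1]
      schwartz_square_moment_integrable[OF schwartz, of 2] by simp_all
  have odd: "(LINT w|lborel. w * (\<eta> w)\<^sup>2) = 0"
    by (rule lborel_integral_odd_eq_0) (simp add: even)
  have bound: "\<bar>?D w\<bar> \<le> \<epsilon>\<^sup>2 * (w\<^sup>2 * (\<eta> w)\<^sup>2)" for w
  proof (cases "0 \<le> ?r w")
    case True
    then have "?D w = \<epsilon>\<^sup>2 * (w\<^sup>2 * (\<eta> w)\<^sup>2)"
      by (simp add: power2_eq_square algebra_simps)
    then show ?thesis
      by simp
  next
    case False
    then have D: "?D w = ((\<epsilon> * w)\<^sup>2 - (?r w)\<^sup>2) * (\<eta> w)\<^sup>2"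
      by (simp add: power2_eq_square algebra_simps)
    \<comment> \<open>\<open>\<epsilon> w \<le> a + \<epsilon> w < 0\<close>, so what the restriction to \<open>r \<ge> 0\<close> cuts off is itself of order \<open>\<epsilon>\<^sup>2\<close>.\<close>
    have "(?r w)\<^sup>2 \<le> (\<epsilon> * w)\<^sup>2"
      using False a by (simp add: abs_le_square_iff[symmetric])
    then have "0 \<le> ((\<epsilon> * w)\<^sup>2 - (?r w)\<^sup>2) * (\<eta> w)\<^sup>2"
      by simp
    moreover have "((\<epsilon> * w)\<^sup>2 - (?r w)\<^sup>2) * (\<eta> w)\<^sup>2 \<le> (\<epsilon> * w)\<^sup>2 * (\<eta> w)\<^sup>2"
      by (intro mult_right_mono) auto
    ultimately show ?thesis
      unfolding D by (simp add: power_mult_distrib)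
  qed
  have f_int: "integrable lborel ?f"
  proof (rule Bochner_Integration.integrable_bound)
    show "integrable lborel (\<lambda>w. a\<^sup>2 * (\<eta> w)\<^sup>2 + 2 * a * \<epsilon> * (w * (\<eta> w)\<^sup>2) + \<epsilon>\<^sup>2 * (w\<^sup>2 * (\<eta> w)\<^sup>2))"
      by (intro Bochner_Integration.integrable_add integrable_mult_right m)
    have "a\<^sup>2 * (\<eta> w)\<^sup>2 + 2 * a * \<epsilon> * (w * (\<eta> w)\<^sup>2) + \<epsilon>\<^sup>2 * (w\<^sup>2 * (\<eta> w)\<^sup>2) = (?r w)\<^sup>2 * (\<eta> w)\<^sup>2" for w
      by (simp add: power2_eq_square algebra_simps)
    then show "AE w in lborel. norm (?f w) \<le>
        norm (a\<^sup>2 * (\<eta> w)\<^sup>2 + 2 * a * \<epsilon> * (w * (\<eta> w)\<^sup>2) + \<epsilon>\<^sup>2 * (w\<^sup>2 * (\<eta> w)\<^sup>2))"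
      by (simp add: indicator_def)
  qed measurable
  have "\<bar>LINT w|lborel. ?D w\<bar> \<le> (LINT w|lborel. \<epsilon>\<^sup>2 * (w\<^sup>2 * (\<eta> w)\<^sup>2))"
    by (rule integral_abs_bound[THEN order_trans], rule integral_mono)
      (intro integrable_abs Bochner_Integration.integrable_diff Bochner_Integration.integrable_add
        integrable_mult_right f_int m bound)+
  also have "(LINT w|lborel. ?D w) = (LINT w|lborel. ?f w) - a\<^sup>2 * (LINT w|lborel. (\<eta> w)\<^sup>2)"
    using f_int m by (simp add: odd)
  finally have main: "\<bar>(LINT w|lborel. ?f w) - a\<^sup>2 * (LINT w|lborel. (\<eta> w)\<^sup>2)\<bar> \<le>
      \<epsilon>\<^sup>2 * (LINT z|lborel. z\<^sup>2 * (\<eta> z)\<^sup>2)"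
    by simp
  have "(LINT r:{0..}|lborel. r\<^sup>2 * (Upsilon' \<eta> a \<epsilon> 2 r)\<^sup>2) =
      (LINT w|lborel. \<epsilon> * (indicator {0..} (?r w) * ((?r w)\<^sup>2 * (Upsilon' \<eta> a \<epsilon> 2 (?r w))\<^sup>2)))"
    unfolding set_lebesgue_integral_def using eps
    by (subst lborel_integral_real_affine[where c = \<epsilon> and t = a]) auto
  \<comment> \<open>One factor \<open>\<epsilon>\<close> from the substitution against the square of
    \<open>1 / (a\<^sup>2 * \<epsilon>)\<close>.\<close>
  also have "\<dots> = (LINT w|lborel. 1 / (a ^ 4 * \<epsilon>) * ?f w)"
    using eps a by (intro Bochner_Integration.integral_cong)
      (auto simp: Upsilon'_def even field_simps eval_nat_numeral)
  also have "\<dots> = 1 / (a ^ 4 * \<epsilon>) * (LINT w|lborel. ?f w)"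
    by simp
  finally have val: "(LINT r:{0..}|lborel. r\<^sup>2 * (Upsilon' \<eta> a \<epsilon> 2 r)\<^sup>2) = \<dots>" .
  have "\<bar>(LINT r:{0..}|lborel. r\<^sup>2 * (Upsilon' \<eta> a \<epsilon> 2 r)\<^sup>2) - (LINT z|lborel. (\<eta> z)\<^sup>2) / (a\<^sup>2 * \<epsilon>)\<bar> =
      \<bar>1 / (a ^ 4 * \<epsilon>) * ((LINT w|lborel. ?f w) - a\<^sup>2 * (LINT w|lborel. (\<eta> w)\<^sup>2))\<bar>"
    unfolding val using eps a by (simp add: field_simps eval_nat_numeral)
  also have "\<dots> = 1 / (a ^ 4 * \<epsilon>) * \<bar>(LINT w|lborel. ?f w) - a\<^sup>2 * (LINT w|lborel. (\<eta> w)\<^sup>2)\<bar>"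
    using eps a by (simp add: abs_mult)
  also have "\<dots> \<le> 1 / (a ^ 4 * \<epsilon>) * (\<epsilon>\<^sup>2 * (LINT z|lborel. z\<^sup>2 * (\<eta> z)\<^sup>2))"
    using eps a by (intro mult_left_mono main) auto
  also have "\<dots> = \<epsilon> * ((LINT z|lborel. z\<^sup>2 * (\<eta> z)\<^sup>2) / a ^ 4)"
    using eps a by (simp add: field_simps power2_eq_square)
  finally show ?thesis .
qed

end

section \<open>Subtraction of the divergence and cancellation of the finite parts\<close>

theorem mainTheorem2:
  fixes \<eta> :: "real \<Rightarrow> real" and \<mu> :: "real ^ 3" and a :: real
  assumes "mollifier \<eta>" and "0 < a" and "a < 1"
  shows "((\<lambda>\<epsilon>. U_mag \<eta> \<mu> a \<epsilon>
            - (norm \<mu>)\<^sup>2 / 3 * (1 / a\<^sup>2) * ((LINT z|lborel. (\<eta> (- z))\<^sup>2) / \<epsilon>))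
          \<longlongrightarrow> 0) (at_right 0)"
proof (rule tendsto_at_right_sequentially[where b = 1])
  \<comment> \<open>Dominated convergence works along sequences; the choice \<open>b = 1\<close>
    supplies \<open>\<epsilon> n < 1\<close>, on which the uniform bounds depend.\<close>
  fix \<epsilon> :: "nat \<Rightarrow> real"
  assume eps: "\<And>n. 0 < \<epsilon> n" "\<And>n. \<epsilon> n < 1" "\<epsilon> \<longlonglongrightarrow> 0"
  interpret mollified_dipole \<eta> a
    by unfold_locales fact+
  let ?M = "LINT z|lborel. (\<eta> z)\<^sup>2"
  let ?AA = "\<lambda>\<epsilon>. LINT r:{0..}|lborel. r\<^sup>2 * (Upsilon \<eta> a \<epsilon> 3 r)\<^sup>2"
  let ?BB = "\<lambda>\<epsilon>. LINT r:{0..}|lborel. r\<^sup>2 * (Upsilon' \<eta> a \<epsilon> 2 r)\<^sup>2"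
  let ?AB = "\<lambda>\<epsilon>. LINT r:{0..}|lborel. r\<^sup>2 * (Upsilon \<eta> a \<epsilon> 3 r * Upsilon' \<eta> a \<epsilon> 2 r)"
  have BB: "(\<lambda>n. ?BB (\<epsilon> n) - ?M / (a\<^sup>2 * \<epsilon> n)) \<longlonglongrightarrow> 0"
  proof (rule Lim_null_comparison)
    show "\<forall>\<^sub>F n in sequentially. norm (?BB (\<epsilon> n) - ?M / (a\<^sup>2 * \<epsilon> n)) \<le>
        \<epsilon> n * ((LINT z|lborel. z\<^sup>2 * (\<eta> z)\<^sup>2) / a ^ 4)"
      using Upsilon'_square_asymp[OF eps(1)] by simp
    show "(\<lambda>n. \<epsilon> n * ((LINT z|lborel. z\<^sup>2 * (\<eta> z)\<^sup>2) / a ^ 4)) \<longlonglongrightarrow> 0"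
      by (intro tendsto_mult_left_zero eps)
  qed
  \<comment> \<open>Moves the counterterm into the B^2 integral, so that each summand has a finite
    limit; \<open>c\<close>, \<open>p\<close>, \<open>e\<close> stand for
    \<open>(norm \<mu>)\<^sup>2\<close>, \<open>a\<^sup>2\<close>,
    \<open>\<epsilon> n\<close>.\<close>
  have collect: "c * (A + (B - M / (p * e)) / 3 - 2 / 3 * C) = c * (A + B / 3 - 2 / 3 * C) - c / 3 * (1 / p) * (M / e)"
    for A B C M c p e :: real
    by (simp add: diff_divide_distrib right_diff_distrib distrib_left)
  have "(\<lambda>n. (norm \<mu>)\<^sup>2 * (?AA (\<epsilon> n) + (?BB (\<epsilon> n) - ?M / (a\<^sup>2 * \<epsilon> n)) / 3 - 2 / 3 * ?AB (\<epsilon> n)))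
      \<longlonglongrightarrow> (norm \<mu>)\<^sup>2 * (1 / (3 * a ^ 3) + 0 / 3 - 2 / 3 * (1 / (2 * a ^ 3)))"
    by (intro tendsto_intros Upsilon_square_tendsto Upsilon_mult_Upsilon'_tendsto BB eps) simp
  also have "(norm \<mu>)\<^sup>2 * (1 / (3 * a ^ 3) + 0 / 3 - 2 / 3 * (1 / (2 * a ^ 3))) = 0"
    by simp
  also have "(\<lambda>n. (norm \<mu>)\<^sup>2 * (?AA (\<epsilon> n) + (?BB (\<epsilon> n) - ?M / (a\<^sup>2 * \<epsilon> n)) / 3 - 2 / 3 * ?AB (\<epsilon> n))) =
      (\<lambda>n. U_mag \<eta> \<mu> a (\<epsilon> n) - (norm \<mu>)\<^sup>2 / 3 * (1 / a\<^sup>2) * ((LINT z|lborel. (\<eta> (- z))\<^sup>2) / \<epsilon> n))"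
    unfolding U_mag_eq_radial_integrals[OF eps(1,2)] even by (rule ext) (rule collect)
  finally show "(\<lambda>n. U_mag \<eta> \<mu> a (\<epsilon> n)
      - (norm \<mu>)\<^sup>2 / 3 * (1 / a\<^sup>2) * ((LINT z|lborel. (\<eta> (- z))\<^sup>2) / \<epsilon> n)) \<longlonglongrightarrow> 0" .
qed simp

end
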